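(* Let $G$ be a finite simple graph with an induced matching $M$ of size $m\ge 1$, let $V(M)$ be the set of the $2m$ endpoints of edges of $M$, and let $r(G)=|V(G)|+1-\chi(G)$. Then \[ \operatorname{lcc}(G)\le \max\{\operatorname{lcc}(G-V(M))+m,\ r(G)-m+1\}. \] Consequently, if $m\ge 2$, then \[ \operatorname{lcc}(G)+\chi(G)\le |V(G)|+3-m . \]
   Context: $\chi(G)$ is the chromatic number; $G-X$ is the subgraph induced by $V(G)\setminus X$. An induced matching is a set $M$ of pairwise disjoint edges of $G$ such that the subgraph of $G$ induced by the set of endpoints of $M$ has no edges other than those of $M$. A clique is a set of pairwise adjacent vertices. An edge-clique cover of $G$ is a family of cliques of $G$ such that both ends of every edge of $G$ lie together in some member of the family. For such a cover $\mathcal C$, the valency of a vertex $v$ is $\operatorname{val}_{\mathcal C}(v)=|\{C\in\mathcal C: v\in C\}|$. The local clique cover number is $\operatorname{lcc}(G)=\min_{\mathcal C}\max_{v\in V(G)}\operatorname{val}_{\mathcal C}(v)$, the minimum taken over all edge-clique covers $\mathcal C$ of $G$. Conventions: $\operatorname{lcc}(G)=0$ for every edgeless graph, and the graph $\varnothing$ with no vertices has $\chi(\varnothing)=\operatorname{lcc}(\varnothing)=0$. *)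

theory Defs
  imports "HOL-Library.Ramsey" "HOL-Library.Disjoint_Sets"
begin

text \<open>A finite simple graph is given by a vertex set \<open>V\<close> and a set \<open>E\<close> of edges, each edge being a
  two-element subset of \<open>V\<close>.  Cliques are those of \<^theory>\<open>HOL-Library.Ramsey\<close>:
  \<open>clique C E\<close> says that the vertices in \<open>C\<close> are pairwise adjacent; \<open>C\<close> may be empty.\<close>

definition fin_simple_graph :: "'a set \<Rightarrow> 'a set set \<Rightarrow> bool" where
  "fin_simple_graph V E \<longleftrightarrow> finite V \<and> E \<subseteq> [V]\<^bsup>2\<^esup>"

definition induced_edges :: "'a set set \<Rightarrow> 'a set \<Rightarrow> 'a set set" where
  "induced_edges E S = {e \<in> E. e \<subseteq> S}"

definition induced_matching :: "'a set set \<Rightarrow> 'a set set \<Rightarrow> bool" where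
  "induced_matching E M \<longleftrightarrow> M \<subseteq> E \<and> disjoint M \<and> induced_edges E (\<Union>M) = M"

definition proper_colouring :: "'a set \<Rightarrow> 'a set set \<Rightarrow> nat \<Rightarrow> ('a \<Rightarrow> nat) \<Rightarrow> bool" where
  "proper_colouring V E k c \<longleftrightarrow>
     c ` V \<subseteq> {..<k} \<and> (\<forall>u\<in>V. \<forall>v\<in>V. {u, v} \<in> E \<longrightarrow> c u \<noteq> c v)"

definition chromatic_number :: "'a set \<Rightarrow> 'a set set \<Rightarrow> nat" where
  "chromatic_number V E = (LEAST k. \<exists>c. proper_colouring V E k c)"

definition edge_clique_cover :: "'a set \<Rightarrow> 'a set set \<Rightarrow> 'a set set \<Rightarrow> bool" where
  "edge_clique_cover V E \<C> \<longleftrightarrow>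
     (\<forall>C\<in>\<C>. C \<subseteq> V \<and> clique C E) \<and> (\<forall>e\<in>E. \<exists>C\<in>\<C>. e \<subseteq> C)"

definition valency :: "'a set set \<Rightarrow> 'a \<Rightarrow> nat" where
  "valency \<C> v = card {C \<in> \<C>. v \<in> C}"

text \<open>The inserted \<open>0\<close> matters only for \<open>V = {}\<close>, where it makes the maximum \<open>0\<close>.\<close>

definition lcc :: "'a set \<Rightarrow> 'a set set \<Rightarrow> nat" where
  "lcc V E = Min {Max (insert 0 (valency \<C> ` V)) | \<C>. edge_clique_cover V E \<C>}"

text \<open>Integer-valued, so that the subtraction is not truncated.\<close>

definition r_number :: "'a set \<Rightarrow> 'a set set \<Rightarrow> int" where
  "r_number V E = int (card V) + 1 - int (chromatic_number V E)"

text \<open>The minimum in \<^const>\<open>lcc\<close> ranges over a finite nonempty set, and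
  the conventions for edgeless and empty graphs hold.\<close>

lemma finite_edge_clique_covers:
  assumes "finite V"
  shows "finite {\<C>. edge_clique_cover V E \<C>}"
proof (rule finite_subset)
  show "{\<C>. edge_clique_cover V E \<C>} \<subseteq> Pow (Pow V)"
    by (auto simp: edge_clique_cover_def)
qed (use assms in simp)

lemma edge_clique_cover_edges:
  assumes "fin_simple_graph V E"
  shows "edge_clique_cover V E E"
  unfolding edge_clique_cover_def
proof (intro conjI ballI)
  fix e assume e: "e \<in> E"
  then have "e \<in> [V]\<^bsup>2\<^esup>" using assms by (auto simp: fin_simple_graph_def)
  then show "e \<subseteq> V" and "clique e E"
    using e by (auto simp: nsets_def clique_def card_2_iff insert_commute)
qed auto

lemma lcc_edgeless:
  assumes "finite V"
  shows "lcc V {} = 0"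
proof -
  let ?A = "{Max (insert 0 (valency \<C> ` V)) | \<C>. edge_clique_cover V {} \<C>}"
  have "finite ?A"
    using finite_imageI[OF finite_edge_clique_covers[OF assms]] by (simp add: setcompr_eq_image)
  moreover have "Max (insert 0 (valency {} ` V)) = 0"
    using assms by (intro Max_eqI) (auto simp: valency_def)
  then have "0 \<in> ?A"
    by (force simp: edge_clique_cover_def)
  ultimately show ?thesis
    unfolding lcc_def by (intro Min_eqI) auto
qed

lemma chromatic_number_empty: "chromatic_number {} {} = 0"
  by (simp add: chromatic_number_def proper_colouring_def)

end

theory Submission
  imports Defs
begin

text \<open>
  Let \<open>\<chi>(X)\<close> denote the chromatic number of the subgraph induced by \<open>X\<close>, and let \<open>n = card V\<close>.

  Suppose the endpoints of a set \<open>F\<close> of pairwise disjoint edges are deleted, leaving the vertex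
  set \<open>W\<close> with an optimal edge-clique cover.  To cover the edges between an edge \<open>uv\<close> of \<open>F\<close>
  and \<open>W\<close>, split the neighbours of \<open>u\<close> and \<open>v\<close> in \<open>W\<close> into those seen by \<open>u\<close> only, by both, and
  by \<open>v\<close> only, partition each of the three parts into as few cliques as possible, and add to every
  clique the ends of \<open>uv\<close> that see the part.  For each edge of \<open>F\<close>, a vertex of \<open>W\<close> lies in at
  most one of the new cliques, so its valency grows by at most \<open>card F\<close>.  Up to a clique for \<open>uv\<close>
  itself when there is no common neighbour, the valency of \<open>u\<close> is a sum of two clique partition
  numbers, and the Nordhaus--Gaddum inequality, applied to the two parts of the neighbourhood of
  \<open>u\<close>, turns it into the bound \<open>card W + 2 - \<chi>(W \<union> {v})\<close> (lemma \<open>edge_star_cover\<close>).  The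
  outcome is \<open>lcc_le_remove_matching\<close>.  For an induced matching of size \<open>m\<close> it gives the first
  inequality, because \<open>n = card W + 2 * m\<close> and \<open>\<chi>(V) \<le> \<chi>(W \<union> {v}) + m\<close>.

  The second inequality needs \<open>lcc + \<chi> \<le> card W + 1\<close> for the graph on \<open>W\<close>.  This bound holds for
  every graph (\<open>lcc_plus_chromatic_number_le\<close>) and follows from the same removal
  lemma by induction: if there are edges \<open>ab\<close>, \<open>cd\<close> and non-edges \<open>ac\<close>, \<open>bd\<close>, delete these four
  vertices.  They induce a bipartite graph, so \<open>\<chi>\<close> drops by at most 2 while \<open>n\<close> drops by 4 and
  the valencies in \<open>W\<close> grow by at most 2.  If there is no such quadruple, the vertices outside a
  maximum clique are pairwise non-adjacent, and an explicit cover works.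
\<close>

section \<open>Chromatic numbers of induced subgraphs\<close>

text \<open>Only edges inside \<open>X\<close> matter for \<open>chromatic_number X E\<close>, so the edge set \<open>E\<close> of the whole
  graph is kept when passing to an induced subgraph.  Colours of an arbitrary type are convenient:
  disjoint palettes are then sum types, and vertices can serve as colours.\<close>

lemma chromatic_number_le_card_colours:
  assumes "finite X" "\<And>u v. u \<in> X \<Longrightarrow> v \<in> X \<Longrightarrow> {u, v} \<in> E \<Longrightarrow> c u \<noteq> c v"
  shows "chromatic_number X E \<le> card (c ` X)"
proof -
  obtain f where f: "bij_betw f (c ` X) {0..<card (c ` X)}"
    using ex_bij_betw_finite_nat assms(1) by blast
  have "proper_colouring X E (card (c ` X)) (f \<circ> c)"
    unfolding proper_colouring_def
  proof (intro conjI ballI impI)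
    show "(f \<circ> c) ` X \<subseteq> {..<card (c ` X)}"
      using f by (auto simp: bij_betw_def)
    fix u v assume "u \<in> X" "v \<in> X" "{u, v} \<in> E"
    then show "(f \<circ> c) u \<noteq> (f \<circ> c) v"
      using assms(2) f by (metis bij_betw_def comp_apply imageI inj_onD)
  qed
  then show ?thesis
    unfolding chromatic_number_def by (intro Least_le) blast
qed

lemma chromatic_number_le:
  assumes "finite X" "finite Q" "c ` X \<subseteq> Q"
    and "\<And>u v. u \<in> X \<Longrightarrow> v \<in> X \<Longrightarrow> {u, v} \<in> E \<Longrightarrow> c u \<noteq> c v"
  shows "chromatic_number X E \<le> card Q"
proof -
  have "chromatic_number X E \<le> card (c ` X)"
    using assms(1,4) by (rule chromatic_number_le_card_colours)
  also have "\<dots> \<le> card Q"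
    using assms(2,3) by (rule card_mono)
  finally show ?thesis .
qed

lemma optimal_colouring:
  assumes "finite X" "\<And>x. {x} \<notin> E"
  obtains c where "proper_colouring X E (chromatic_number X E) c"
proof -
  obtain f where f: "bij_betw f X {0..<card X}"
    using ex_bij_betw_finite_nat assms(1) by blast
  have "proper_colouring X E (card X) f"
    unfolding proper_colouring_def
  proof (intro conjI ballI impI notI)
    show "f ` X \<subseteq> {..<card X}"
      using f by (auto simp: bij_betw_def)
    fix u v assume uv: "u \<in> X" "v \<in> X" "{u, v} \<in> E" "f u = f v"
    then have "u = v"
      using f by (meson bij_betw_def inj_onD)
    with uv assms(2) show False by simp
  qed
  then have "\<exists>k c. proper_colouring X E k c" by blast
  then have "\<exists>c. proper_colouring X E (chromatic_number X E) c"
    unfolding chromatic_number_def by (rule LeastI_ex)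
  with that show ?thesis by blast
qed

lemma chromatic_number_le_card:
  assumes "finite X" "\<And>x. {x} \<notin> E"
  shows "chromatic_number X E \<le> card X"
  using assms by (intro chromatic_number_le[where c = id]) auto

lemma chromatic_number_mono:
  assumes "finite Y" "\<And>x. {x} \<notin> E" "X \<subseteq> Y"
  shows "chromatic_number X E \<le> chromatic_number Y E"
proof -
  obtain c where c: "proper_colouring Y E (chromatic_number Y E) c"
    using optimal_colouring assms(1,2) by blast
  have "chromatic_number X E \<le> card {..<chromatic_number Y E}"
    using c assms by (intro chromatic_number_le[where c = c])
      (auto simp: proper_colouring_def dest: finite_subset, blast)
  then show ?thesis by simp
qed

lemma chromatic_number_Un:
  assumes "finite X" "finite Y" "\<And>x. {x} \<notin> E"
  shows "chromatic_number (X \<union> Y) E \<le> chromatic_number X E + chromatic_number Y E"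
proof -
  obtain c d where c: "proper_colouring X E (chromatic_number X E) c"
    and d: "proper_colouring Y E (chromatic_number Y E) d"
    using optimal_colouring[OF assms(1,3)] optimal_colouring[OF assms(2,3)] by metis
  have "chromatic_number (X \<union> Y) E
      \<le> card ({..<chromatic_number X E} <+> {..<chromatic_number Y E})"
    using assms c d
    by (intro chromatic_number_le[where c = "\<lambda>x. if x \<in> X then Inl (c x) else Inr (d x)"])
      (auto simp: proper_colouring_def)
  then show ?thesis by (simp add: card_Plus)
qed

lemma chromatic_number_insert:
  assumes "finite X" "\<And>x. {x} \<notin> E"
  shows "chromatic_number (insert x X) E \<le> Suc (chromatic_number X E)"
proof -
  have "chromatic_number {x} E \<le> 1"
    using chromatic_number_le_card[of "{x}" E] assms(2) by simp
  then show ?thesis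
    using chromatic_number_Un[of "{x}" X E] assms by simp
qed

lemma chromatic_number_insert_small_degree:
  assumes "finite X" "\<And>x. {x} \<notin> E"
    and deg: "card {y \<in> X. {x, y} \<in> E} < chromatic_number X E"
  shows "chromatic_number (insert x X) E \<le> chromatic_number X E"
proof (cases "x \<in> X")
  case True
  then show ?thesis by (simp add: insert_absorb)
next
  case False
  obtain c where c: "proper_colouring X E (chromatic_number X E) c"
    using optimal_colouring assms(1,2) by blast
  let ?N = "{y \<in> X. {x, y} \<in> E}"
  have "card (c ` ?N) < card {..<chromatic_number X E}"
    using deg card_image_le[of ?N c] assms(1) by simp
  then have "\<not> {..<chromatic_number X E} \<subseteq> c ` ?N"
    using card_mono[of "c ` ?N" "{..<chromatic_number X E}"] assms(1) by auto
  then obtain i where i: "i < chromatic_number X E" "i \<notin> c ` ?N" by auto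
  have "chromatic_number (insert x X) E \<le> card {..<chromatic_number X E}"
  proof (intro chromatic_number_le[where c = "c(x := i)"])
    show "(c(x := i)) ` insert x X \<subseteq> {..<chromatic_number X E}"
      using c i by (auto simp: proper_colouring_def)
    fix u v assume uv: "u \<in> insert x X" "v \<in> insert x X" "{u, v} \<in> E"
    then have "u \<noteq> v" using assms(2) by auto
    with uv c i(2) show "(c(x := i)) u \<noteq> (c(x := i)) v"
      by (auto simp: proper_colouring_def insert_commute)
  qed (use assms(1) in auto)
  then show ?thesis by simp
qed

lemma chromatic_number_induced_edges:
  "chromatic_number X (induced_edges E X) = chromatic_number X E"
  by (simp add: chromatic_number_def proper_colouring_def induced_edges_def)

section \<open>The Nordhaus--Gaddum inequality\<close>

definition co_edges :: "'a set set \<Rightarrow> 'a set set" where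
  "co_edges E = {{u, v} | u v. u \<noteq> v \<and> {u, v} \<notin> E}"

lemma doubleton_in_co_edges: "{u, v} \<in> co_edges E \<longleftrightarrow> u \<noteq> v \<and> {u, v} \<notin> E"
  unfolding co_edges_def by (auto simp: doubleton_eq_iff insert_commute)

lemma singleton_notin_co_edges: "{x} \<notin> co_edges E"
  using doubleton_in_co_edges[of x x E] by simp

text \<open>When a vertex \<open>x\<close> is added, each of the two chromatic numbers grows by at most one, and it
  does not grow if \<open>x\<close> has fewer neighbours than there are colours.  As the degrees of \<open>x\<close> in the
  graph and in its complement sum to \<open>card X\<close>, both numbers can only grow when their old sum was
  at most \<open>card X\<close>.\<close>

theorem nordhaus_gaddum:
  assumes "finite X" and loopless: "\<And>x. {x} \<notin> E"
  shows "chromatic_number X E + chromatic_number X (co_edges E) \<le> card X + 1"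
  using assms(1)
proof (induction X)
  case empty
  then show ?case
    using chromatic_number_le_card[of "{}" E] chromatic_number_le_card[OF finite.emptyI singleton_notin_co_edges, of E]
      loopless by simp
next
  case (insert x X)
  let ?N = "{y \<in> X. {x, y} \<in> E}" and ?N' = "{y \<in> X. {x, y} \<in> co_edges E}"
  have "?N \<union> ?N' = X" "?N \<inter> ?N' = {}"
    using insert.hyps by (auto simp: doubleton_in_co_edges)
  then have degs: "card ?N + card ?N' = card X"
    using card_Un_disjoint[of ?N ?N'] insert.hyps(1) by simp
  note up = chromatic_number_insert[OF insert.hyps(1) loopless, of x]
    chromatic_number_insert[OF insert.hyps(1) singleton_notin_co_edges, of x E]
  consider "card ?N < chromatic_number X E" | "card ?N' < chromatic_number X (co_edges E)"
    | "chromatic_number X E + chromatic_number X (co_edges E) \<le> card X"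
    using degs by linarith
  then show ?case
  proof cases
    case 1
    then have "chromatic_number (insert x X) E \<le> chromatic_number X E"
      by (rule chromatic_number_insert_small_degree[OF insert.hyps(1) loopless])
    with up insert.IH insert.hyps show ?thesis by simp
  next
    case 2
    then have "chromatic_number (insert x X) (co_edges E) \<le> chromatic_number X (co_edges E)"
      by (rule chromatic_number_insert_small_degree[OF insert.hyps(1) singleton_notin_co_edges])
    with up insert.IH insert.hyps show ?thesis by simp
  next
    case 3
    with up insert.hyps show ?thesis by simp
  qed
qed

section \<open>Covering the edges that meet a given edge\<close>

lemma clique_partition:
  assumes "finite X" "\<And>x. {x} \<notin> E"
  shows "\<exists>(f :: 'a \<Rightarrow> nat) t. f ` X \<subseteq> {..<t} \<and> (\<forall>i. clique {x \<in> X. f x = i} E)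
    \<and> t + chromatic_number X E \<le> card X + 1 \<and> (X = {} \<longrightarrow> t = 0)"
proof -
  obtain f where f: "proper_colouring X (co_edges E) (chromatic_number X (co_edges E)) f"
    using optimal_colouring[OF assms(1) singleton_notin_co_edges] by blast
  show ?thesis
  proof (intro exI conjI allI impI)
    show "f ` X \<subseteq> {..<chromatic_number X (co_edges E)}"
      using f by (simp add: proper_colouring_def)
    show "clique {x \<in> X. f x = i} E" for i
      using f unfolding clique_def proper_colouring_def doubleton_in_co_edges by blast
    show "chromatic_number X (co_edges E) + chromatic_number X E \<le> card X + 1"
      using nordhaus_gaddum[OF assms] by simp
    show "chromatic_number X (co_edges E) = 0" if "X = {}"
      using that chromatic_number_le_card[OF assms(1) singleton_notin_co_edges, of E] by simp
  qed
qed

lemma valency_Un_le: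
  shows "valency (\<C> \<union> \<D>) v \<le> valency \<C> v + valency \<D> v"
proof -
  have "{C \<in> \<C> \<union> \<D>. v \<in> C} = {C \<in> \<C>. v \<in> C} \<union> {C \<in> \<D>. v \<in> C}" by auto
  then show ?thesis by (simp add: valency_def card_Un_le)
qed

lemma valency_image_le:
  assumes "finite I"
  shows "valency (g ` I) v \<le> card {i \<in> I. v \<in> g i}"
proof -
  have "{C \<in> g ` I. v \<in> C} = g ` {i \<in> I. v \<in> g i}" by auto
  then show ?thesis using assms by (simp add: valency_def card_image_le)
qed

lemma valency_0: "(\<And>C. C \<in> \<C> \<Longrightarrow> v \<notin> C) \<Longrightarrow> valency \<C> v = 0"
  unfolding valency_def by (metis (mono_tags, lifting) Collect_empty_eq card.empty)

lemma valency_le_card: "finite \<C> \<Longrightarrow> valency \<C> v \<le> card \<C>"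
  by (auto simp: valency_def intro: card_mono)

text \<open>The members of \<open>\<D>\<close> are the classes of a clique partition of \<open>X\<close>, each enlarged by the
  common set \<open>T\<close>.\<close>

definition star_cliques :: "'a set set \<Rightarrow> 'a set \<Rightarrow> 'a set \<Rightarrow> 'a set set \<Rightarrow> bool" where
  "star_cliques E T X \<D> \<longleftrightarrow> finite \<D> \<and> (\<forall>C\<in>\<D>. C \<subseteq> T \<union> X \<and> clique C E)
     \<and> (\<forall>x\<in>X. (\<exists>C\<in>\<D>. insert x T \<subseteq> C) \<and> valency \<D> x \<le> 1)"

text \<open>The edges inside \<open>W\<close> need not be covered: these cliques are to be added to a cover of the
  subgraph induced by \<open>W\<close>.\<close>

definition link_cover :: "'a set set \<Rightarrow> 'a set \<Rightarrow> 'a set \<Rightarrow> 'a set set \<Rightarrow> bool" where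
  "link_cover E e W \<D> \<longleftrightarrow> finite \<D> \<and> (\<forall>C\<in>\<D>. C \<subseteq> e \<union> W \<and> clique C E)
     \<and> (\<exists>C\<in>\<D>. e \<subseteq> C) \<and> (\<forall>x\<in>e. \<forall>w\<in>W. {x, w} \<in> E \<longrightarrow> (\<exists>C\<in>\<D>. {x, w} \<subseteq> C))
     \<and> (\<forall>w\<in>W. valency \<D> w \<le> 1)"

text \<open>When \<open>T\<close> is completely joined to \<open>X\<close>, every class of an optimal clique partition of \<open>X\<close>
  can absorb \<open>T\<close>; the bound on the number of classes is \<open>nordhaus_gaddum\<close>.  That inequality
  leaves a spare 1 when \<open>X\<close> is empty, and both uses of this lemma exploit the
  spare 1.\<close>

lemma ex_star_cliques:
  assumes "finite X" "\<And>x. {x} \<notin> E" "T \<inter> X = {}" "clique T E"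
    and join: "\<And>s x. s \<in> T \<Longrightarrow> x \<in> X \<Longrightarrow> {s, x} \<in> E"
  shows "\<exists>\<D>. star_cliques E T X \<D> \<and> card \<D> + chromatic_number X E \<le> card X + 1
    \<and> (X = {} \<longrightarrow> \<D> = {})"
proof -
  from clique_partition[OF assms(1,2)] obtain f :: "'a \<Rightarrow> nat" and t
    where f: "f ` X \<subseteq> {..<t}" "\<And>i. clique {x \<in> X. f x = i} E"
      and t: "t + chromatic_number X E \<le> card X + 1" "X = {} \<longrightarrow> t = 0"
    by (elim exE conjE) simp
  define g where "g i = T \<union> {x \<in> X. f x = i}" for i
  show ?thesis
    unfolding star_cliques_def
  proof (intro exI[of _ "g ` {..<t}"] conjI ballI impI)
    show "finite (g ` {..<t})" by simp
    fix C assume "C \<in> g ` {..<t}"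
    then obtain i where C: "C = g i" by (rule imageE)
    show "C \<subseteq> T \<union> X" by (auto simp: C g_def)
    show "clique C E"
    proof -
      have "{s, x} \<in> E \<and> {x, s} \<in> E" if "s \<in> T" "x \<in> X" for s x
        using join[OF that] by (simp add: insert_commute)
      then show ?thesis
        using f(2)[of i] assms(4) unfolding C g_def clique_def by blast
    qed
  next
    fix x assume x: "x \<in> X"
    show "\<exists>C\<in>g ` {..<t}. insert x T \<subseteq> C"
      using x f(1) by (intro bexI[of _ "g (f x)"]) (auto simp: g_def)
    show "valency (g ` {..<t}) x \<le> 1"
    proof -
      have "x \<in> g i \<longleftrightarrow> i = f x" for i
        using x assms(3) by (auto simp: g_def)
      then have "valency (g ` {..<t}) x \<le> card {i \<in> {..<t}. i = f x}"
        using valency_image_le[of "{..<t}" g x] by simp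
      also have "\<dots> \<le> card {f x}" by (intro card_mono) auto
      finally show ?thesis by simp
    qed
  next
    have "card (g ` {..<t}) \<le> t" using card_image_le[of "{..<t}" g] by simp
    with t(1) show "card (g ` {..<t}) + chromatic_number X E \<le> card X + 1" by linarith
    show "g ` {..<t} = {}" if "X = {}" using t(2) that by simp
  qed
qed

text \<open>Let \<open>A\<close> consist of the vertices of \<open>W\<close> adjacent to \<open>u\<close> only, and \<open>B\<close> of those adjacent to
  both \<open>u\<close> and \<open>v\<close>.  The cliques at \<open>u\<close> come from the classes of clique partitions of
  \<open>A\<close> and \<open>B\<close>, and there are at most \<open>(card A + 1 - \<chi>(A)) + (card B + 1 - \<chi>(B))\<close> of them.  On the
  other hand \<open>W\<close> can be coloured with \<open>\<chi>(A) + \<chi>(B)\<close> colours and one further colour for every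
  vertex outside \<open>A \<union> B\<close>, and \<open>v\<close> may reuse a colour of \<open>A\<close>, or be
  paid for by the spare 1 of an empty \<open>A\<close>.  Adding up gives the bound for \<open>u\<close>;
  the one for \<open>v\<close> is symmetric.\<close>

lemma edge_star_cover:
  assumes "finite W" and loopless: "\<And>x. {x} \<notin> E" and uv: "{u, v} \<in> E" "u \<notin> W" "v \<notin> W"
  shows "\<exists>\<D>. link_cover E {u, v} W \<D>
    \<and> valency \<D> u + chromatic_number (insert v W) E \<le> card W + 2
    \<and> valency \<D> v + chromatic_number (insert u W) E \<le> card W + 2"
proof -
  define only where "only x y = {w \<in> W. {x, w} \<in> E \<and> {y, w} \<notin> E}" for x y
  define B where "B = {w \<in> W. {u, w} \<in> E \<and> {v, w} \<in> E}"
  have finp: "finite (only x y)" and pW: "only x y \<subseteq> W" for x y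
    using assms(1) by (auto simp: only_def)
  have finB: "finite B" and BW: "B \<subseteq> W" using assms(1) by (auto simp: B_def)
  have "u \<noteq> v" using uv(1) loopless by auto
  have "\<exists>\<D>. star_cliques E {x} (only x y) \<D>
      \<and> card \<D> + chromatic_number (only x y) E \<le> card (only x y) + 1
      \<and> (only x y = {} \<longrightarrow> \<D> = {})" if "x \<in> {u, v}" for x y
    using that uv pW[of x y]
    by (intro ex_star_cliques[OF finp[of x y] loopless]) (auto simp: clique_def only_def)
  then obtain P where P: "\<And>x y. x \<in> {u, v} \<Longrightarrow> star_cliques E {x} (only x y) (P x y)"
    and cardP: "\<And>x y. x \<in> {u, v} \<Longrightarrow>
      card (P x y) + chromatic_number (only x y) E \<le> card (only x y) + 1"
    and P_empty: "\<And>x y. x \<in> {u, v} \<Longrightarrow> only x y = {} \<Longrightarrow> P x y = {}"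
    by metis
  note P = P[unfolded star_cliques_def]
  have P_sub: "C \<subseteq> {x} \<union> only x y" if "x \<in> {u, v}" "C \<in> P x y" for x y C
    using P[OF that(1), of y] that(2) by simp
  have "\<exists>\<D>. star_cliques E {u, v} B \<D> \<and> card \<D> + chromatic_number B E \<le> card B + 1
      \<and> (B = {} \<longrightarrow> \<D> = {})"
    using uv BW by (intro ex_star_cliques[OF finB loopless])
      (auto simp: clique_def B_def insert_commute)
  then obtain \<B>0 where B0': "star_cliques E {u, v} B \<B>0"
    and cardB0: "card \<B>0 + chromatic_number B E \<le> card B + 1"
    by blast
  note B0 = B0'[unfolded star_cliques_def]
  \<comment> \<open>If \<open>u\<close> and \<open>v\<close> have no common neighbour, the edge itself must be added as a clique;
    this costs the spare 1 in \<open>card B + 1 - \<chi>(B)\<close>.\<close>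
  define \<B> where "\<B> = (if B = {} then {{u, v}} else \<B>0)"
  have cl: "clique {u, v} E" using uv(1) by (auto simp: clique_def insert_commute)
  have B: "finite \<B>" "\<And>C. C \<in> \<B> \<Longrightarrow> C \<subseteq> {u, v} \<union> B \<and> clique C E"
    "\<And>x. x \<in> B \<Longrightarrow> \<exists>C\<in>\<B>. insert x {u, v} \<subseteq> C" "\<And>x. x \<in> B \<Longrightarrow> valency \<B> x \<le> 1"
    using B0 cl by (auto simp: \<B>_def split: if_splits)
  have cardB: "card \<B> + chromatic_number B E \<le> card B + 1"
    using cardB0 chromatic_number_le_card[of "{}" E] loopless by (auto simp: \<B>_def)
  have coverB: "\<exists>C\<in>\<B>. {u, v} \<subseteq> C"
  proof (cases "B = {}")
    case True
    then show ?thesis by (simp add: \<B>_def)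
  next
    case False
    then obtain x where "x \<in> B" by blast
    from B(3)[OF this] show ?thesis by auto
  qed
  define \<D> where "\<D> = \<B> \<union> (P u v \<union> P v u)"
  have finD: "finite (P u v)" "finite (P v u)" using P by auto
  have val: "valency \<D> w \<le> valency \<B> w + (valency (P u v) w + valency (P v u) w)" for w
    unfolding \<D>_def using valency_Un_le[of \<B> "P u v \<union> P v u" w]
      valency_Un_le[of "P u v" "P v u" w] by simp
  have bound: "valency \<B> x + valency (P x y) x + chromatic_number (insert y W) E \<le> card W + 2"
    if xy: "(x, y) = (u, v) \<or> (x, y) = (v, u)" for x y
  proof -
    let ?A = "only x y" and ?R = "W - only x y - B"
    have x: "x \<in> {u, v}" using xy by auto
    \<comment> \<open>The colour of \<open>y\<close> comes for free: \<open>y\<close> has no neighbour in \<open>?A\<close>, and if \<open>?A\<close>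
      is empty then no clique is spent on it.\<close>
    have A: "card (P x y) + chromatic_number (insert y ?A) E \<le> card ?A + 1"
    proof (cases "?A = {}")
      case True
      then show ?thesis
        using P_empty[OF x] chromatic_number_le_card[of "{y}" E] loopless by simp
    next
      case False
      have "chromatic_number ?A E \<noteq> 0"
      proof
        assume "chromatic_number ?A E = 0"
        with False show False
          using optimal_colouring[OF finp loopless, of x y] by (force simp: proper_colouring_def)
      qed
      moreover have "{z \<in> ?A. {y, z} \<in> E} = {}" by (auto simp: only_def)
      then have "card {z \<in> ?A. {y, z} \<in> E} = 0" by (simp only: card.empty)
      ultimately have "chromatic_number (insert y ?A) E \<le> chromatic_number ?A E"
        by (intro chromatic_number_insert_small_degree[OF finp loopless]) linarith
      then show ?thesis using cardP[OF x, of y] by simp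
    qed
    have part: "insert y W = insert y ?A \<union> (B \<union> ?R)" using pW BW by auto
    have "?A \<inter> B = {}" using xy by (auto simp: only_def B_def)
    then have "card (?A \<union> B) = card ?A + card B"
      using finp finB by (intro card_Un_disjoint)
    moreover have "card W = card (?A \<union> B) + card ?R"
    proof -
      have "W = (?A \<union> B) \<union> ?R" using pW BW by auto
      then show ?thesis
        using card_Un_disjoint[of "?A \<union> B" ?R] finp finB assms(1) by fastforce
    qed
    moreover have "chromatic_number (insert y W) E
        \<le> chromatic_number (insert y ?A) E + (chromatic_number B E + card ?R)"
    proof -
      have "chromatic_number (insert y W) E
          \<le> chromatic_number (insert y ?A) E + chromatic_number (B \<union> ?R) E"
        unfolding part using finp finB assms(1) loopless by (intro chromatic_number_Un) auto
      also have "chromatic_number (B \<union> ?R) E \<le> chromatic_number B E + chromatic_number ?R E"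
        using finB assms(1) loopless by (intro chromatic_number_Un) auto
      also have "chromatic_number ?R E \<le> card ?R"
        using assms(1) loopless by (intro chromatic_number_le_card) auto
      finally show ?thesis by simp
    qed
    moreover have "valency \<B> x \<le> card \<B>" using B(1) by (rule valency_le_card)
    moreover have "valency (P x y) x \<le> card (P x y)"
      using P[OF x, of y] by (intro valency_le_card) simp
    ultimately show ?thesis using A cardB by linarith
  qed
  show ?thesis
    unfolding link_cover_def
  proof (intro exI[of _ \<D>] conjI)
    show "finite \<D>" using B(1) finD by (simp add: \<D>_def)
    show "\<forall>C\<in>\<D>. C \<subseteq> {u, v} \<union> W \<and> clique C E"
    proof
      fix C assume "C \<in> \<D>"
      then consider "C \<in> \<B>" | "C \<in> P u v" | "C \<in> P v u" by (auto simp: \<D>_def)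
      then show "C \<subseteq> {u, v} \<union> W \<and> clique C E"
      proof cases
        case 1
        then show ?thesis using B(2) BW by blast
      next
        case 2
        then show ?thesis using P[of u v] pW[of u v] by blast
      next
        case 3
        then show ?thesis using P[of v u] pW[of v u] by blast
      qed
    qed
    show "\<exists>C\<in>\<D>. {u, v} \<subseteq> C" using coverB by (auto simp: \<D>_def)
    have "\<exists>C\<in>\<D>. {x, w} \<subseteq> C" if "x \<in> {u, v}" "w \<in> W" "{x, w} \<in> E" for x w
    proof -
      define y where "y = (if x = u then v else u)"
      have y: "(x, y) = (u, v) \<or> (x, y) = (v, u)" using that(1) by (auto simp: y_def)
      show ?thesis
      proof (cases "w \<in> B")
        case True
        then show ?thesis using B(3)[OF True] that(1) by (auto simp: \<D>_def)
      next
        case False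
        then have "w \<in> only x y" using that y by (auto simp: B_def only_def)
        then have "\<exists>C\<in>P x y. {w, x} \<subseteq> C" using P[OF that(1)] by blast
        moreover have "P x y \<subseteq> \<D>" using y by (auto simp: \<D>_def)
        ultimately show ?thesis by (metis insert_commute subsetD)
      qed
    qed
    then show "\<forall>x\<in>{u, v}. \<forall>w\<in>W. {x, w} \<in> E \<longrightarrow> (\<exists>C\<in>\<D>. {x, w} \<subseteq> C)" by blast
    have "valency \<D> w \<le> 1" if "w \<in> W" for w
    proof -
      have *: "valency (P x y) w = 0" if "x \<in> {u, v}" "w \<notin> only x y" for x y
        using P_sub[OF that(1)] that \<open>w \<in> W\<close> uv(2,3) by (intro valency_0) blast
      have **: "valency \<B> w = 0" if "w \<notin> B"
        using B(2) that \<open>w \<in> W\<close> uv(2,3) by (intro valency_0) blast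
      consider "w \<in> B" "w \<notin> only u v" "w \<notin> only v u"
        | "w \<notin> B" "w \<in> only u v" "w \<notin> only v u"
        | "w \<notin> B" "w \<notin> only u v"
        by (auto simp: B_def only_def)
      then show ?thesis
      proof cases
        case 1
        then show ?thesis using val[of w] *[of u v] *[of v u] B(4)[of w] by simp
      next
        case 2
        then have "valency (P u v) w \<le> 1" using P[of u v] by blast
        with 2 show ?thesis using val[of w] *[of v u] ** by simp
      next
        case 3
        have "valency (P v u) w \<le> 1"
          using P[of v u] *[of v u] by (cases "w \<in> only v u") auto
        with 3 show ?thesis using val[of w] *[of u v] ** by simp
      qed
    qed
    then show "\<forall>w\<in>W. valency \<D> w \<le> 1" by blast
    have "valency (P v u) u = 0"
      using P_sub[of v _ u] \<open>u \<noteq> v\<close> pW[of v u] uv(2) by (intro valency_0) blast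
    then show "valency \<D> u + chromatic_number (insert v W) E \<le> card W + 2"
      using bound[of u v] val[of u] by simp
    have "valency (P u v) v = 0"
      using P_sub[of u _ v] \<open>u \<noteq> v\<close> pW[of u v] uv(3) by (intro valency_0) blast
    then show "valency \<D> v + chromatic_number (insert u W) E \<le> card W + 2"
      using bound[of v u] val[of v] by simp
  qed
qed

section \<open>Removing a matching\<close>

lemma fin_simple_graph_loopless: "fin_simple_graph V E \<Longrightarrow> {x} \<notin> E"
  by (auto simp: fin_simple_graph_def nsets_def)

lemma fin_simple_graph_edgeE:
  assumes "fin_simple_graph V E" "e \<in> E"
  obtains u v where "e = {u, v}" "u \<noteq> v" "u \<in> V" "v \<in> V"
proof -
  have "card e = 2" "e \<subseteq> V" using assms by (auto simp: fin_simple_graph_def nsets_def)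
  then show ?thesis using that by (auto simp: card_2_iff)
qed

lemma fin_simple_graph_induced:
  "fin_simple_graph V E \<Longrightarrow> X \<subseteq> V \<Longrightarrow> fin_simple_graph X (induced_edges E X)"
  by (auto simp: fin_simple_graph_def induced_edges_def nsets_def intro: finite_subset)

lemma lcc_le:
  assumes "finite V" "edge_clique_cover V E \<C>" "\<And>v. v \<in> V \<Longrightarrow> valency \<C> v \<le> K"
  shows "lcc V E \<le> K"
proof -
  have "lcc V E \<le> Max (insert 0 (valency \<C> ` V))"
    unfolding lcc_def using assms(2) finite_imageI[OF finite_edge_clique_covers[OF assms(1)]]
    by (intro Min_le) (auto simp: setcompr_eq_image)
  also have "\<dots> \<le> K" using assms(1,3) by (subst Max_le_iff) auto
  finally show ?thesis .
qed

lemma optimal_edge_clique_cover: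
  assumes "fin_simple_graph V E"
  obtains \<C> where "edge_clique_cover V E \<C>" "\<And>v. v \<in> V \<Longrightarrow> valency \<C> v \<le> lcc V E"
proof -
  have fin: "finite V" using assms by (simp add: fin_simple_graph_def)
  let ?A = "{Max (insert 0 (valency \<C> ` V)) | \<C>. edge_clique_cover V E \<C>}"
  have "lcc V E \<in> ?A"
    unfolding lcc_def
    using finite_imageI[OF finite_edge_clique_covers[OF fin]] edge_clique_cover_edges[OF assms]
    by (intro Min_in) (auto simp: setcompr_eq_image)
  then obtain \<C> where "edge_clique_cover V E \<C>" and eq: "lcc V E = Max (insert 0 (valency \<C> ` V))"
    by blast
  moreover have "valency \<C> v \<le> lcc V E" if "v \<in> V" for v
    unfolding eq using that fin by (intro Max_ge) auto
  ultimately show ?thesis using that by blast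
qed

lemma valency_UN_le:
  assumes "finite I"
  shows "valency (\<Union>i\<in>I. D i) v \<le> (\<Sum>i\<in>I. valency (D i) v)"
proof -
  have "{C \<in> \<Union>i\<in>I. D i. v \<in> C} = (\<Union>i\<in>I. {C \<in> D i. v \<in> C})" by auto
  then show ?thesis using assms by (simp add: valency_def card_UN_le)
qed

text \<open>The hypothesis \<open>rest\<close> controls the valencies in \<open>W\<close>, and \<open>ends\<close> those of the deleted
  vertices.  Besides the cliques of \<open>edge_star_cover\<close>, a deleted vertex lies in the edges that join
  it to other edges of the matching; each of these is used as a clique on its own, whence the
  second cardinality in \<open>ends\<close>.\<close>

lemma lcc_le_remove_matching:
  assumes G: "fin_simple_graph V E" and F: "F \<subseteq> E" "disjoint F"
    and W_def: "W = V - \<Union>F"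
    and rest: "lcc W (induced_edges E W) + card F \<le> K"
    and ends: "\<And>u v. {u, v} \<in> F \<Longrightarrow>
      card W + 2 + card {e \<in> induced_edges E (\<Union>F) - F. u \<in> e} \<le> K + chromatic_number (insert v W) E"
  shows "lcc V E \<le> K"
proof -
  have finV: "finite V" and EV: "\<And>e. e \<in> E \<Longrightarrow> e \<subseteq> V" and finW: "finite W"
    using G by (auto simp: fin_simple_graph_def nsets_def W_def)
  have finE: "finite E" by (rule finite_subset[of _ "Pow V"]) (use finV EV in auto)
  then have finF: "finite F" using F(1) finite_subset by blast
  note loopless = fin_simple_graph_loopless[OF G]
  define good where "good e \<D> \<longleftrightarrow> link_cover E e W \<D>
      \<and> (\<forall>x y. e = {x, y} \<longrightarrow> valency \<D> x + chromatic_number (insert y W) E \<le> card W + 2)"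
    for e \<D>
  have "\<exists>\<D>. good e \<D>" if "e \<in> F" for e
  proof -
    have "e \<in> E" using that F(1) by blast
    then obtain u v where e: "e = {u, v}" "u \<noteq> v"
      by (rule fin_simple_graph_edgeE[OF G])
    have uv: "{u, v} \<in> E" "u \<notin> W" "v \<notin> W" using that F(1) e by (auto simp: W_def)
    from edge_star_cover[OF finW loopless uv] obtain \<D> where
      link: "link_cover E {u, v} W \<D>"
      and val: "valency \<D> u + chromatic_number (insert v W) E \<le> card W + 2"
        "valency \<D> v + chromatic_number (insert u W) E \<le> card W + 2"
      by (elim exE conjE)
    have "valency \<D> x + chromatic_number (insert y W) E \<le> card W + 2" if "e = {x, y}" for x y
      using that val unfolding e(1) doubleton_eq_iff by blast
    with link show ?thesis unfolding good_def e(1)[symmetric] by blast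
  qed
  then obtain D where "\<And>e. e \<in> F \<Longrightarrow> good e (D e)" by metis
  note D = this[unfolded good_def link_cover_def]
  obtain \<C> where C: "edge_clique_cover W (induced_edges E W) \<C>"
    "\<And>w. w \<in> W \<Longrightarrow> valency \<C> w \<le> lcc W (induced_edges E W)"
    using optimal_edge_clique_cover[OF fin_simple_graph_induced[OF G, of W]] W_def by blast
  define X where "X = induced_edges E (\<Union>F) - F"
  define \<A> where "\<A> = \<C> \<union> ((\<Union>e\<in>F. D e) \<union> X)"
  have val: "valency \<A> x \<le> valency \<C> x + ((\<Sum>e\<in>F. valency (D e) x) + valency X x)" for x
  proof -
    have "valency (\<Union>e\<in>F. D e) x \<le> (\<Sum>e\<in>F. valency (D e) x)"
      using finF by (rule valency_UN_le)
    then show ?thesis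
      unfolding \<A>_def
      using valency_Un_le[of \<C> "(\<Union>e\<in>F. D e) \<union> X" x] valency_Un_le[of "\<Union>e\<in>F. D e" X x]
        by simp
  qed
  have cover: "edge_clique_cover V E \<A>"
    unfolding edge_clique_cover_def
  proof (intro conjI ballI)
    fix Q assume "Q \<in> \<A>"
    then consider "Q \<in> \<C>" | e where "e \<in> F" "Q \<in> D e" | "Q \<in> X" by (auto simp: \<A>_def)
    then have "Q \<subseteq> V \<and> clique Q E"
    proof cases
      case 1
      then have "Q \<subseteq> W" "clique Q (induced_edges E W)"
        using C(1) by (auto simp: edge_clique_cover_def)
      then show ?thesis by (simp add: W_def clique_def induced_edges_def subset_iff)
    next
      case 2
      then have "Q \<subseteq> e \<union> W" "clique Q E" using D by blast+
      moreover have "e \<subseteq> V" using 2(1) F(1) EV by blast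
      ultimately show ?thesis by (auto simp: W_def)
    next
      case 3
      then have "Q \<in> E" by (simp add: X_def induced_edges_def)
      then show ?thesis
        using edge_clique_cover_edges[OF G] by (auto simp: edge_clique_cover_def)
    qed
    then show "Q \<subseteq> V" "clique Q E" by auto
  next
    fix e assume e: "e \<in> E"
    then obtain u v where uv: "e = {u, v}" "u \<in> V" "v \<in> V"
      using fin_simple_graph_edgeE[OF G] by blast
    have mixed: "\<exists>Q\<in>\<A>. e \<subseteq> Q" if xw: "e = {x, w}" "x \<in> \<Union>F" "w \<in> W" for x w
    proof -
      obtain f where f: "f \<in> F" "x \<in> f" using xw(2) by blast
      have "\<forall>x\<in>f. \<forall>w\<in>W. {x, w} \<in> E \<longrightarrow> (\<exists>C\<in>D f. {x, w} \<subseteq> C)"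
        using D[OF f(1)] by (elim conjE)
      then have "\<exists>Q\<in>D f. e \<subseteq> Q" using f(2) xw e by simp
      with \<open>f \<in> F\<close> show ?thesis by (auto simp: \<A>_def)
    qed
    consider "u \<in> W" "v \<in> W" | "u \<in> \<Union>F" "v \<in> W" | "u \<in> W" "v \<in> \<Union>F"
      | "u \<in> \<Union>F" "v \<in> \<Union>F" using uv by (auto simp: W_def)
    then show "\<exists>Q\<in>\<A>. e \<subseteq> Q"
    proof cases
      case 1
      then have "e \<in> induced_edges E W" using e uv by (simp add: induced_edges_def)
      then have "\<exists>Q\<in>\<C>. e \<subseteq> Q" using C(1) by (simp add: edge_clique_cover_def)
      then show ?thesis by (auto simp: \<A>_def)
    next
      case 2
      then show ?thesis using mixed[of u v] uv by blast
    next
      case 3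
      then show ?thesis using mixed[of v u] uv by (simp add: insert_commute)
    next
      case 4
      then have "e \<in> induced_edges E (\<Union>F)" using e uv by (simp add: induced_edges_def)
      then consider "e \<in> F" | "e \<in> X" by (auto simp: X_def)
      then show ?thesis
      proof cases
        case 1
        then have "\<exists>Q\<in>D e. e \<subseteq> Q" using D by blast
        with 1 show ?thesis by (auto simp: \<A>_def)
      qed (auto simp: \<A>_def)
    qed
  qed
  have "valency \<A> x \<le> K" if xV: "x \<in> V" for x
  proof (cases "x \<in> W")
    case True
    have "valency X x = 0"
      using True by (intro valency_0) (auto simp: X_def induced_edges_def W_def)
    moreover have "(\<Sum>e\<in>F. valency (D e) x) \<le> (\<Sum>e\<in>F. 1)"
      using D True by (intro sum_mono) blast
    ultimately show ?thesis using val[of x] C(2)[OF True] rest by simp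
  next
    case False
    then obtain f where f: "f \<in> F" "x \<in> f" using xV by (auto simp: W_def)
    then obtain a b where ab: "f = {a, b}"
      using fin_simple_graph_edgeE[OF G, of f] F(1) by (metis subsetD)
    define y where "y = (if x = a then b else a)"
    have y: "f = {x, y}" using f(2) ab by (auto simp: y_def)
    have "valency (D e) x = 0" if "e \<in> F - {f}" for e
    proof (rule valency_0)
      fix Q assume "Q \<in> D e"
      then have "Q \<subseteq> e \<union> W" using D that by blast
      moreover have "x \<notin> e" using disjointD[OF F(2), of e f] that f by auto
      ultimately show "x \<notin> Q" using False by blast
    qed
    then have "(\<Sum>e\<in>F. valency (D e) x) = valency (D f) x"
      using sum.remove[OF finF f(1), of "\<lambda>e. valency (D e) x"] by simp
    moreover have "valency \<C> x = 0"
      using C(1) False by (intro valency_0) (auto simp: edge_clique_cover_def)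
    moreover have "valency (D f) x + chromatic_number (insert y W) E \<le> card W + 2"
    proof -
      have "\<forall>x y. f = {x, y} \<longrightarrow> valency (D f) x + chromatic_number (insert y W) E \<le> card W + 2"
        using D[OF f(1)] by (elim conjE)
      with y show ?thesis by blast
    qed
    moreover have "card W + 2 + valency X x \<le> K + chromatic_number (insert y W) E"
      using ends[of x y] f(1) y by (simp add: valency_def X_def)
    ultimately show ?thesis using val[of x] by simp
  qed
  then show ?thesis by (rule lcc_le[OF finV cover])
qed

section \<open>The bound for all graphs\<close>

lemma ex_max_clique:
  assumes "finite V"
  obtains K where "K \<subseteq> V" "clique K E" "\<And>K'. K' \<subseteq> V \<Longrightarrow> clique K' E \<Longrightarrow> card K' \<le> card K"
proof -
  let ?S = "{K. K \<subseteq> V \<and> clique K E}"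
  have "finite ?S" "{} \<in> ?S" using assms by (auto simp: clique_def)
  then have "Max (card ` ?S) \<in> card ` ?S" by (intro Max_in) auto
  then obtain K where K: "K \<in> ?S" "Max (card ` ?S) = card K" by (rule imageE) simp
  have "card K' \<le> card K" if "K' \<in> ?S" for K'
    unfolding K(2)[symmetric] using \<open>finite ?S\<close> that by (intro Max_ge) auto
  with that K(1) show ?thesis by blast
qed

text \<open>The cover consists of \<open>K\<close> and, for every vertex outside \<open>K\<close>, of that vertex together with
  its neighbours, so all valencies are at most \<open>1 + card (V - K)\<close>.  As each vertex outside \<open>K\<close> can
  take the colour of a non-neighbour in \<open>K\<close>, \<open>card K\<close> colours suffice.\<close>

lemma lcc_chromatic_split:
  assumes G: "fin_simple_graph V E" and K: "K \<subseteq> V" "clique K E"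
    and indep: "\<And>x y. x \<in> V - K \<Longrightarrow> y \<in> V - K \<Longrightarrow> {x, y} \<notin> E"
    and nonadj: "\<And>x. x \<in> V - K \<Longrightarrow> \<exists>k\<in>K. {x, k} \<notin> E"
  shows "lcc V E + chromatic_number V E \<le> card V + 1"
proof -
  have finV: "finite V" using G by (simp add: fin_simple_graph_def)
  then have finK: "finite K" using K(1) finite_subset by blast
  note loopless = fin_simple_graph_loopless[OF G]
  obtain p where p: "\<And>x. x \<in> V - K \<Longrightarrow> p x \<in> K \<and> {x, p x} \<notin> E"
    using nonadj by metis
  have chi: "chromatic_number V E \<le> card K"
  proof (intro chromatic_number_le[where c = "\<lambda>x. if x \<in> K then x else p x"])
    show "(\<lambda>x. if x \<in> K then x else p x) ` V \<subseteq> K" using p by auto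
    fix u v assume uv: "u \<in> V" "v \<in> V" "{u, v} \<in> E"
    then have "u \<noteq> v" using loopless by auto
    with uv indep p[of u] p[of v]
    show "(if u \<in> K then u else p u) \<noteq> (if v \<in> K then v else p v)"
      by (auto simp: insert_commute)
  qed (use finV finK in auto)
  define star where "star x = insert x {k \<in> K. {x, k} \<in> E}" for x
  let ?\<C> = "{K} \<union> star ` (V - K)"
  have "edge_clique_cover V E ?\<C>"
    unfolding edge_clique_cover_def
  proof (intro conjI ballI)
    fix Q assume "Q \<in> ?\<C>"
    then consider "Q = K" | x where "x \<in> V - K" "Q = star x" by blast
    then have "Q \<subseteq> V \<and> clique Q E"
    proof cases
      case 1
      then show ?thesis using K by simp
    next
      case 2
      have "clique {k \<in> K. {x, k} \<in> E} E" using K(2) by (simp add: clique_def)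
      then have "clique (star x) E"
        unfolding star_def clique_def by (simp add: insert_commute)
      with 2 K(1) show ?thesis by (auto simp: star_def)
    qed
    then show "Q \<subseteq> V" "clique Q E" by simp_all
  next
    fix e assume e: "e \<in> E"
    then obtain u v where uv: "e = {u, v}" "u \<in> V" "v \<in> V"
      using fin_simple_graph_edgeE[OF G] by blast
    consider "u \<in> K" "v \<in> K" | "u \<in> K" "v \<in> V - K" | "u \<in> V - K" "v \<in> K"
      using e uv indep by blast
    then show "\<exists>Q\<in>?\<C>. e \<subseteq> Q"
    proof cases
      case 2
      then have "e \<subseteq> star v" using e uv by (auto simp: star_def insert_commute)
      with 2 show ?thesis by blast
    next
      case 3
      then have "e \<subseteq> star u" using e uv by (auto simp: star_def)
      with 3 show ?thesis by blast
    qed (use uv in auto)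
  qed
  moreover have "valency ?\<C> x \<le> Suc (card (V - K))" for x
  proof -
    have "valency ?\<C> x \<le> card ?\<C>" using finV by (intro valency_le_card) auto
    also have "\<dots> \<le> card {K} + card (star ` (V - K))" by (rule card_Un_le)
    also have "\<dots> \<le> Suc (card (V - K))" using finV card_image_le[of "V - K" star] by simp
    finally show ?thesis .
  qed
  ultimately have "lcc V E \<le> Suc (card (V - K))"
    by (rule lcc_le[OF finV])
  then show ?thesis
    using chi finV finK K(1) card_Diff_subset[of K V] card_mono[of V K] by linarith
qed

text \<open>The quadruple in the case distinction is an alternating 4-cycle; its vertices induce a perfect
  matching on two edges, a path, or a 4-cycle.  As all of these are bipartite, deleting the 4
  vertices lowers \<open>card V + 1 - \<chi>\<close> by at least 2, which pays for the two matching edges.  The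
  graphs without alternating 4-cycles are the threshold graphs, and what is used of their structure
  is that removing a maximum clique leaves an independent set.\<close>

theorem lcc_plus_chromatic_number_le:
  assumes "fin_simple_graph V E"
  shows "lcc V E + chromatic_number V E \<le> card V + 1"
  using assms
proof (induction "card V" arbitrary: V E rule: less_induct)
  case less
  note G = less.prems
  have finV: "finite V" using G by (simp add: fin_simple_graph_def)
  note loopless = fin_simple_graph_loopless[OF G]
  show ?case
  proof (cases "\<exists>a b c d. {a, b} \<in> E \<and> {c, d} \<in> E \<and> a \<noteq> c \<and> b \<noteq> d \<and> {a, c} \<notin> E \<and> {b, d} \<notin> E")
    case True
    then obtain a b c d where abcd: "{a, b} \<in> E" "{c, d} \<in> E" "a \<noteq> c" "b \<noteq> d"
      "{a, c} \<notin> E" "{b, d} \<notin> E" by blast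
    have sub: "{a, b} \<subseteq> V" "{c, d} \<subseteq> V"
      using abcd G by (auto simp: fin_simple_graph_def nsets_def)
    have ne: "a \<noteq> b" "c \<noteq> d" using abcd loopless by auto
    have ne': "a \<noteq> d" "b \<noteq> c" using abcd by (auto simp: insert_commute)
    define F where "F = {{a, b}, {c, d}}"
    define W where "W = V - \<Union>F"
    have UF: "\<Union>F = {a, b, c, d}" by (auto simp: F_def)
    have cardF: "card F = 2" using ne ne' abcd by (simp add: F_def doubleton_eq_iff)
    have card4: "card {a, b, c, d} = 4" using ne ne' abcd(3,4) by simp
    have cardV: "card V = card W + 4"
      using sub finV card_mono[of V "{a, b, c, d}"] card4
      by (simp add: W_def UF card_Diff_subset)
    have finW: "finite W" using finV by (simp add: W_def)
    \<comment> \<open>The colour classes are the two non-edges.\<close>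
    have chi4: "chromatic_number {a, b, c, d} E \<le> card {True, False}"
      using abcd ne ne' loopless
      by (intro chromatic_number_le[where c = "\<lambda>x. x = a \<or> x = c"]) (auto simp: insert_commute)
    have VW: "V = W \<union> {a, b, c, d}" using sub by (auto simp: W_def UF)
    have chiV: "chromatic_number V E \<le> chromatic_number W E + 2"
      using chromatic_number_Un[of W "{a, b, c, d}" E] chi4 finW loopless VW by simp
    have IH: "lcc W (induced_edges E W) + chromatic_number W E \<le> card W + 1"
      using less.hyps[of W "induced_edges E W"] fin_simple_graph_induced[OF G, of W] cardV
      by (simp add: chromatic_number_induced_edges W_def)
    have le: "chromatic_number V E \<le> card V"
      using chromatic_number_le_card finV loopless by blast
    have "lcc V E \<le> card V + 1 - chromatic_number V E"
    proof (rule lcc_le_remove_matching[OF G, of F W])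
      show "F \<subseteq> E" using abcd by (simp add: F_def)
      show "disjoint F" using ne' abcd(3,4) by (auto simp: F_def disjoint_def)
      show "W = V - \<Union>F" by (rule W_def)
      show "lcc W (induced_edges E W) + card F \<le> card V + 1 - chromatic_number V E"
        using IH cardF cardV chiV by linarith
      fix u v assume uv: "{u, v} \<in> F"
      \<comment> \<open>Since \<open>ac\<close> and \<open>bd\<close> are non-edges, the only possible neighbour of \<open>u\<close> in the quadruple
        beyond its partner in \<open>F\<close> is the following vertex.\<close>
      define opp where "opp = (if u = a then d else if u = b then c else if u = c then b else a)"
      have "{e \<in> induced_edges E (\<Union>F) - F. u \<in> e} \<subseteq> {{u, opp}}"
      proof
        fix e assume e: "e \<in> {e \<in> induced_edges E (\<Union>F) - F. u \<in> e}"
        then have e': "e \<in> E" "e \<subseteq> {a, b, c, d}" "e \<notin> F" "u \<in> e"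
          by (auto simp: induced_edges_def UF)
        obtain w where w: "e = {u, w}"
          using fin_simple_graph_edgeE[OF G e'(1)] e'(4)
          by (metis insertE insert_commute singletonD)
        have "w = opp"
          using e' abcd ne ne' loopless unfolding w F_def opp_def
          by (auto simp: insert_commute doubleton_eq_iff)
        then show "e \<in> {{u, opp}}" using w by simp
      qed
      then have "card {e \<in> induced_edges E (\<Union>F) - F. u \<in> e} \<le> 1"
        using card_mono[of "{{u, opp}}"] by fastforce
      moreover have "chromatic_number W E \<le> chromatic_number (insert v W) E"
        using finW loopless by (intro chromatic_number_mono) auto
      ultimately show "card W + 2 + card {e \<in> induced_edges E (\<Union>F) - F. u \<in> e}
          \<le> card V + 1 - chromatic_number V E + chromatic_number (insert v W) E"
        using cardV chiV by linarith
    qed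
    with le show ?thesis by linarith
  next
    case False
    then have four: "{a, c} \<in> E \<or> {b, d} \<in> E"
      if "{a, b} \<in> E" "{c, d} \<in> E" "a \<noteq> c" "b \<noteq> d" for a b c d
      using that by blast
    obtain K where K: "K \<subseteq> V" "clique K E"
      and max: "\<And>K'. K' \<subseteq> V \<Longrightarrow> clique K' E \<Longrightarrow> card K' \<le> card K"
      using ex_max_clique finV by blast
    have finK: "finite K" using K(1) finV finite_subset by blast
    have nonadj: "\<exists>k\<in>K. {x, k} \<notin> E" if x: "x \<in> V - K" for x
    proof (rule ccontr)
      assume "\<not> (\<exists>k\<in>K. {x, k} \<notin> E)"
      then have "clique (insert x K) E"
        using K(2) by (auto simp: clique_def insert_commute)
      then show False using max[of "insert x K"] x K(1) finK by simp
    qed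
    have "{x, y} \<notin> E" if x: "x \<in> V - K" and y: "y \<in> V - K" for x y
    proof
      assume xy: "{x, y} \<in> E"
      then have "x \<noteq> y" using loopless by auto
      obtain k where k: "k \<in> K" "{x, k} \<notin> E" using nonadj x by blast
      have others: "{y, k'} \<in> E" if "k' \<in> K" "k' \<noteq> k" for k'
      proof -
        have "{k, k'} \<in> E" using K(2) k(1) that by (auto simp: clique_def)
        moreover have "x \<noteq> k" "y \<noteq> k'" using k(1) that(1) x y by auto
        ultimately show ?thesis using four[OF xy] k(2) by blast
      qed
      then have yk: "{y, k} \<notin> E" using nonadj[OF y] by blast
      have others': "{x, k'} \<in> E" if "k' \<in> K" "k' \<noteq> k" for k'
      proof -
        have "{k', k} \<in> E" using K(2) k(1) that by (auto simp: clique_def)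
        moreover have "x \<noteq> k'" "y \<noteq> k" using k(1) that(1) x y by auto
        ultimately show ?thesis using four[OF xy] yk by blast
      qed
      \<comment> \<open>Both \<open>x\<close> and \<open>y\<close> miss only \<open>k\<close>, so exchanging \<open>k\<close> for the two of them enlarges \<open>K\<close>.\<close>
      have "clique (insert x (insert y (K - {k}))) E"
        using K(2) xy others others' by (auto simp: clique_def insert_commute)
      then have "card (insert x (insert y (K - {k}))) \<le> card K"
        by (intro max) (use K(1) x y in auto)
      moreover have "card (insert x (insert y (K - {k}))) = Suc (Suc (card (K - {k})))"
        using x y finK \<open>x \<noteq> y\<close> by simp
      ultimately show False using finK k(1) card_gt_0_iff[of K] by (auto simp: card_Diff_singleton)
    qed
    then show ?thesis using lcc_chromatic_split[OF G K] nonadj by blast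
  qed
qed

section \<open>Induced matchings\<close>

lemma chromatic_number_induced_matching:
  assumes "fin_simple_graph V E" "induced_matching E M"
  shows "chromatic_number (\<Union>M) E \<le> 2"
proof -
  have M: "M \<subseteq> E" "disjoint M" "induced_edges E (\<Union>M) = M"
    using assms(2) by (auto simp: induced_matching_def)
  note loopless = fin_simple_graph_loopless[OF assms(1)]
  have "\<Union>M \<subseteq> V" using M(1) assms(1) by (auto simp: fin_simple_graph_def nsets_def)
  then have fin: "finite (\<Union>M)"
    using assms(1) finite_subset by (auto simp: fin_simple_graph_def)
  \<comment> \<open>One end \<open>p e\<close> of every edge is chosen; the chosen ends form one colour class.\<close>
  have "\<exists>x. x \<in> e" if "e \<in> M" for e
    using that M(1) fin_simple_graph_edgeE[OF assms(1)] by (metis insertI1 subsetD)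
  then obtain p where p: "\<And>e. e \<in> M \<Longrightarrow> p e \<in> e" by metis
  have uniq: "e = f" if "e \<in> M" "f \<in> M" "p f \<in> e" for e f
    using disjointD[OF M(2), of e f] that p[of f] by blast
  have "chromatic_number (\<Union>M) E \<le> card {True, False}"
  proof (rule chromatic_number_le[where c = "\<lambda>x. x \<in> p ` M"])
    fix u v assume "u \<in> \<Union>M" "v \<in> \<Union>M" and uv: "{u, v} \<in> E"
    then have e: "{u, v} \<in> M" using M(3) by (auto simp: induced_edges_def)
    have iff: "x \<in> p ` M \<longleftrightarrow> x = p {u, v}" if x: "x \<in> {u, v}" for x
    proof
      assume "x \<in> p ` M"
      then obtain f where f: "x = p f" "f \<in> M" by (rule imageE)
      then have "{u, v} = f" using uniq[OF e f(2)] x by simp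
      with f(1) show "x = p {u, v}" by simp
    qed (use e in simp)
    have "u \<noteq> v" using uv loopless by auto
    then show "(u \<in> p ` M) \<noteq> (v \<in> p ` M)"
      using iff[of u] iff[of v] p[OF e] by auto
  qed (use fin in auto)
  then show ?thesis by simp
qed

theorem theorem3p3:
  fixes V :: "'a set" and E M :: "'a set set" and m :: nat
  assumes "fin_simple_graph V E"
    and "induced_matching E M" and "card M = m" and "m \<ge> 1"
  shows "int (lcc V E) \<le>
           max (int (lcc (V - \<Union>M) (induced_edges E (V - \<Union>M))) + int m)
               (r_number V E - int m + 1)
         \<and> (m \<ge> 2 \<longrightarrow>
              int (lcc V E) + int (chromatic_number V E) \<le> int (card V) + 3 - int m)"
proof -
  note G = assms(1)
  note loopless = fin_simple_graph_loopless[OF G]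
  have M: "M \<subseteq> E" "disjoint M" "induced_edges E (\<Union>M) = M"
    using assms(2) by (auto simp: induced_matching_def)
  have finV: "finite V" and MV: "\<Union>M \<subseteq> V" and card2: "\<And>e. e \<in> M \<Longrightarrow> card e = 2"
    using M(1) G by (auto simp: fin_simple_graph_def nsets_def)
  define W where "W = V - \<Union>M"
  have finW: "finite W" using finV by (simp add: W_def)
  have "card (\<Union>M) = (\<Sum>e\<in>M. card e)"
    using M(2) card2 by (intro card_Union_disjoint)
      (auto simp: disjoint_def pairwise_def disjnt_def intro: card_ge_0_finite)
  then have "card (\<Union>M) = 2 * m" using card2 assms(3) by simp
  then have cardV: "card V = card W + 2 * m"
    using MV finV card_mono[OF finV MV] card_Diff_subset[of "\<Union>M" V] finite_subset[OF MV finV]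
    by (simp add: W_def)
  have chiV: "chromatic_number V E \<le> chromatic_number W E + 2"
  proof -
    have "V = W \<union> \<Union>M" using MV by (auto simp: W_def)
    then show ?thesis
      using chromatic_number_Un[OF finW finite_subset[OF MV finV] loopless]
        chromatic_number_induced_matching[OF G assms(2)] by fastforce
  qed
  \<comment> \<open>For \<open>m = 1\<close> the two extra colours of \<open>chiV\<close> are one too many; there it matters that
    \<open>v\<close> is already coloured along with \<open>W\<close>, so that only \<open>u\<close> needs a new colour.\<close>
  have chi_ends: "chromatic_number V E \<le> chromatic_number (insert v W) E + m" if "{u, v} \<in> M" for u v
  proof (cases "m = 1")
    case True
    then have "M = {{u, v}}" using assms(3) that card_1_singletonE by blast
    then have "V = insert u (insert v W)" using MV by (auto simp: W_def)
    then show ?thesis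
      using chromatic_number_insert[of "insert v W" E u] finW loopless True by simp
  next
    case False
    have "chromatic_number W E \<le> chromatic_number (insert v W) E"
      using finW loopless by (intro chromatic_number_mono) auto
    with False assms(4) chiV show ?thesis by linarith
  qed
  define b where "b = max (int (lcc W (induced_edges E W)) + int m) (r_number V E - int m + 1)"
  have "lcc V E \<le> nat b"
  proof (rule lcc_le_remove_matching[OF G M(1,2) W_def])
    show "lcc W (induced_edges E W) + card M \<le> nat b" using assms(3) by (simp add: b_def)
    fix u v assume "{u, v} \<in> M"
    then have "chromatic_number V E \<le> chromatic_number (insert v W) E + m" by (rule chi_ends)
    then show "card W + 2 + card {e \<in> induced_edges E (\<Union>M) - M. u \<in> e}
        \<le> nat b + chromatic_number (insert v W) E"
      using cardV by (simp add: M(3) b_def r_number_def)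
  qed
  then have bound: "int (lcc V E) \<le> b" by (simp add: b_def)
  have "lcc W (induced_edges E W) + chromatic_number W E \<le> card W + 1"
    using lcc_plus_chromatic_number_le[OF fin_simple_graph_induced[OF G, of W]]
    by (simp add: chromatic_number_induced_edges W_def)
  then have "int (lcc V E) + int (chromatic_number V E) \<le> int (card V) + 3 - int m"
    using bound cardV chiV by (auto simp: b_def r_number_def)
  with bound show ?thesis by (simp add: b_def W_def)
qed

end
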